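(* Let $q$ be a prime power and let $f=xg$ where $g\in\mathbb{F}_q[x]$ is a permutation polynomial with $g(0)=0$. Then $f$ is projectively equivalent to the polynomial $xh$, where $h$ is the permutation polynomial with $h(0)=0$ satisfying $h(x)=\big(g^{-1}(x^{-1})\big)^{-1}$ for all $x\in\mathbb{F}_q^*$ (here $g^{-1}$ denotes the compositional inverse of the permutation induced by $g$).
   Context: For $u\in\mathbb{F}_q[x]$, $S_u=\{(x,u(x),1):x\in\mathbb{F}_q\}\cup\{(0,1,0)\}\subset\mathrm{PG}(2,q)$, the projective plane over $\mathbb{F}_q$. Two polynomials $u_1,u_2$ are projectively equivalent if some collineation of $\mathrm{PG}(2,q)$ (element of $\mathrm{P\Gamma L}(3,q)$) maps $S_{u_1}$ onto $S_{u_2}$. A permutation polynomial is one inducing a bijection of $\mathbb{F}_q$. *)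

theory Defs
  imports "HOL-Analysis.Cartesian_Space" "HOL-Computational_Algebra.Polynomial"
begin

text \<open>
  The field of \<open>q\<close> elements is a type \<open>'a :: {field, finite}\<close>, with \<open>q = CARD('a)\<close>.
  The points of \<open>PG(2,q)\<close> are the one-dimensional subspaces of \<open>'a ^ 3\<close>.
\<close>

definition pg_points :: "('a::{field,finite} ^ 3) set set" where
  "pg_points = {P. vec.subspace P \<and> vec.dim P = 1}"

definition pg_point :: "'a::{field,finite} \<Rightarrow> 'a \<Rightarrow> 'a \<Rightarrow> ('a ^ 3) set" where
  "pg_point x y z = vec.span {vector [x, y, z]}"

definition field_automorphism :: "('a::field \<Rightarrow> 'a) \<Rightarrow> bool" where
  "field_automorphism \<sigma> \<longleftrightarrow>
     bij \<sigma> \<and> (\<forall>a b. \<sigma> (a + b) = \<sigma> a + \<sigma> b) \<and> (\<forall>a b. \<sigma> (a * b) = \<sigma> a * \<sigma> b)"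

definition GammaL3 :: "('a::{field,finite} ^ 3 \<Rightarrow> 'a ^ 3) set" where
  "GammaL3 = {\<phi>. bij \<phi> \<and> (\<forall>v w. \<phi> (v + w) = \<phi> v + \<phi> w) \<and>
     (\<exists>\<sigma>. field_automorphism \<sigma> \<and> (\<forall>c v. \<phi> (c *s v) = \<sigma> c *s \<phi> v))}"

text \<open>
  Restricting the induced maps to the set of points identifies exactly those semilinear maps
  that differ by a nonzero scalar factor, so this is the quotient group acting on points.
\<close>

definition PGammaL3 :: "(('a::{field,finite} ^ 3) set \<Rightarrow> ('a ^ 3) set) set" where
  "PGammaL3 = (\<lambda>\<phi>. restrict (\<lambda>P. \<phi> ` P) pg_points) ` GammaL3"

definition S_set :: "'a::{field,finite} poly \<Rightarrow> ('a ^ 3) set set" where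
  "S_set u = {pg_point x (poly u x) 1 | x. True} \<union> {pg_point 0 1 0}"

definition projectively_equivalent :: "'a::{field,finite} poly \<Rightarrow> 'a poly \<Rightarrow> bool" where
  "projectively_equivalent u1 u2 \<longleftrightarrow> (\<exists>\<kappa>\<in>PGammaL3. \<kappa> ` S_set u1 = S_set u2)"

definition permutation_polynomial :: "'a::{field,finite} poly \<Rightarrow> bool" where
  "permutation_polynomial u \<longleftrightarrow> bij (poly u)"

lemma pg_point_in_pg_points:
  assumes "x \<noteq> 0 \<or> y \<noteq> 0 \<or> z \<noteq> 0"
  shows "pg_point x y z \<in> pg_points"
proof -
  have "(vector [x, y, z] :: 'a ^ 3) \<noteq> 0"
    using assms by (metis vector_3 zero_index)
  then have "vec.independent {vector [x, y, z] :: 'a ^ 3}"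
    by simp
  then show ?thesis
    unfolding pg_point_def pg_points_def
    by (simp add: vec.dim_eq_card_independent)
qed

lemma S_set_subset_pg_points: "S_set u \<subseteq> pg_points"
  by (auto simp: S_set_def pg_point_in_pg_points)

end

theory Submission imports Defs begin

text \<open>
  The collineation exchanges the last two coordinates. It swaps \<open>(0,0,1)\<close> and \<open>(0,1,0)\<close>, and
  for \<open>x \<noteq> 0\<close> it sends \<open>(x, x g(x), 1)\<close> to \<open>(x, 1, x g(x))\<close>, which is proportional to
  \<open>(y, y x\<^sup>-\<^sup>1, 1)\<close> with \<open>y = g(x)\<^sup>-\<^sup>1\<close>; and \<open>x = g\<^sup>-\<^sup>1(y\<^sup>-\<^sup>1)\<close> means \<open>x\<^sup>-\<^sup>1 = h(y)\<close>.
\<close>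

text \<open>Newton's scheme: the product of the factors \<open>[:-b, 1:]\<close> over
  \<open>b\<close> in \<open>A\<close> vanishes on \<open>A\<close> but not at a new point
  \<open>a\<close>, so a suitable multiple of it corrects the value at \<open>a\<close> and keeps
  the others.\<close>

lemma poly_interpolation_exists:
  fixes F :: "'a::field \<Rightarrow> 'a"
  assumes "finite A"
  shows "\<exists>p. degree p \<le> card A - 1 \<and> (\<forall>a\<in>A. poly p a = F a)"
  using assms
proof (induction A rule: finite_induct)
  case empty
  \<comment> \<open>Subtraction is truncated, so the degree bound is \<open>0\<close> here.\<close>
  show ?case by (intro exI[of _ 0]) simp
next
  case (insert a A)
  then obtain p where p: "degree p \<le> card A - 1" "\<forall>b\<in>A. poly p b = F b"
    by blast
  define w where "w = (\<Prod>b\<in>A. [:-b, 1:])"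
  have wA: "poly w b = 0" if "b \<in> A" for b
    using that insert.hyps by (auto simp: w_def poly_prod)
  have wa: "poly w a \<noteq> 0"
    using insert.hyps by (auto simp: w_def poly_prod)
  have "degree w \<le> (\<Sum>b\<in>A. degree [:-b, 1:])"
    unfolding w_def using degree_prod_sum_le insert.hyps(1) by (metis comp_apply sum.cong)
  then have dw: "degree w \<le> card A"
    by simp
  define r where "r = p + smult ((F a - poly p a) / poly w a) w"
  have "degree r \<le> card A"
    unfolding r_def using p(1) dw
    by (intro degree_add_le order.trans[OF degree_smult_le]) auto
  moreover have "\<forall>b\<in>insert a A. poly r b = F b"
    using p(2) wA wa by (auto simp: r_def)
  ultimately show ?case
    using insert.hyps by (intro exI[of _ r]) simp
qed

text \<open>A nonzero difference would have degree below \<open>q\<close> and yet all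
  \<open>q\<close> field elements as roots.\<close>

lemma poly_eq_if_degree_less_CARD:
  fixes p r :: "'a::{field,finite} poly"
  assumes "degree p < CARD('a)" "degree r < CARD('a)" "\<And>x. poly p x = poly r x"
  shows "p = r"
proof (rule ccontr)
  assume "p \<noteq> r"
  then have "card {x. poly (p - r) x = 0} \<le> degree (p - r)"
    by (intro card_poly_roots_bound) simp
  moreover have "degree (p - r) < CARD('a)"
    using assms(1,2) by (rule degree_diff_less)
  ultimately show False
    using assms(3) by simp
qed

text \<open>Values determine a polynomial over a finite field only once its degree is bounded by
  \<open>q - 1\<close>; this makes \<open>h\<close> in the theorem a well-defined
  polynomial.\<close>

lemma poly_of_fun_ex1:
  fixes F :: "'a::{field,finite} \<Rightarrow> 'a"
  shows "\<exists>!p. degree p < CARD('a) \<and> poly p = F"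
proof (rule ex_ex1I)
  obtain p where "degree p \<le> CARD('a) - 1" "\<forall>a. poly p a = F a"
    using poly_interpolation_exists[of UNIV F] by auto
  moreover have "CARD('a) > 0"
    by (simp add: finite_UNIV_card_ge_0)
  ultimately have "degree p < CARD('a) \<and> poly p = F"
    by (intro conjI ext) (linarith, blast)
  then show "\<exists>p. degree p < CARD('a) \<and> poly p = F" ..
next
  fix p r :: "'a poly"
  assume "degree p < CARD('a) \<and> poly p = F" "degree r < CARD('a) \<and> poly r = F"
  then show "p = r"
    by (intro poly_eq_if_degree_less_CARD) auto
qed

lemma pg_point_scale:
  fixes c :: "'a::{field,finite}"
  assumes "c \<noteq> 0"
  shows "pg_point (c * x) (c * y) (c * z) = pg_point x y z"
proof -
  have "(vector [c * x, c * y, c * z] :: 'a ^ 3) = c *s vector [x, y, z]"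
    by (simp add: vec_eq_iff forall_3)
  moreover have "range (\<lambda>k. k *s (c *s v)) = range (\<lambda>k. k *s v)" for v :: "'a ^ 3"
  proof (intro equalityI subsetI)
    fix w assume "w \<in> range (\<lambda>k. k *s v)"
    then obtain k where "w = (k / c) *s (c *s v)"
      using assms by auto
    then show "w \<in> range (\<lambda>k. k *s (c *s v))" by blast
  qed auto
  ultimately show ?thesis
    by (simp add: pg_point_def vec.span_singleton)
qed

definition swap23 :: "'a::{field,finite} ^ 3 \<Rightarrow> 'a ^ 3" where
  "swap23 v = vector [v $ 1, v $ 3, v $ 2]"

lemma swap23_swap23: "swap23 (swap23 v) = v"
  by (simp add: swap23_def vec_eq_iff forall_3)

lemma swap23_scale: "swap23 (c *s v) = c *s swap23 v"
  by (simp add: swap23_def vec_eq_iff forall_3)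

lemma swap23_in_GammaL3: "swap23 \<in> GammaL3"
proof -
  have "bij swap23"
    by (rule involuntory_imp_bij) (rule swap23_swap23)
  moreover have "swap23 (v + w) = swap23 v + swap23 w" for v w :: "'a ^ 3"
    by (simp add: swap23_def vec_eq_iff forall_3)
  moreover have "field_automorphism (id :: 'a \<Rightarrow> 'a)"
    by (simp add: field_automorphism_def)
  ultimately show ?thesis
    unfolding GammaL3_def using swap23_scale by (auto intro!: exI[of _ id])
qed

lemma swap23_image_pg_point: "swap23 ` pg_point x y z = pg_point x z y"
proof -
  have "swap23 (vector [x, y, z]) = vector [x, z, y]"
    by (simp add: swap23_def)
  then show ?thesis
    by (simp add: pg_point_def vec.span_singleton image_image swap23_scale)
qed

lemma swap23_image_S_set:
  assumes g: "bij (poly g)" "poly g 0 = 0"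
    and h: "poly h 0 = 0" "\<And>x. x \<noteq> 0 \<Longrightarrow> poly h x = inverse (inv (poly g) (inverse x))"
  shows "(`) swap23 ` S_set ([:0, 1:] * g) = S_set ([:0, 1:] * h)"
proof -
  have g_nz: "poly g x \<noteq> 0" if "x \<noteq> 0" for x
    using g that by (metis bij_pointE)
  \<comment> \<open>The factor of proportionality is \<open>x * poly g x\<close>, which is nonzero;
    that it carries the right triple to the left one follows from \<open>poly g x * y = 1\<close>
    and \<open>x * poly h y = 1\<close>.\<close>
  have aff: "pg_point x 1 (x * poly g x) = pg_point y (y * poly h y) 1"
    if "x \<noteq> 0" "y = inverse (poly g x)" for x y
  proof -
    have "poly h y = inverse x"
      using that g_nz h(2) bij_is_inj[OF g(1)] by (simp add: inv_f_f)
    then have "poly g x * y = 1" "x * poly h y = 1"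
      using that g_nz[of x] by simp_all
    then have "x * poly g x * y = x" "x * poly g x * (y * poly h y) = 1"
      by algebra+
    then show ?thesis
      using that(1) g_nz[of x] pg_point_scale[of "x * poly g x" y "y * poly h y" 1]
      by (metis mult.right_neutral mult_eq_0_iff)
  qed
  show ?thesis
  proof (intro equalityI subsetI)
    fix P assume "P \<in> (`) swap23 ` S_set ([:0, 1:] * g)"
    then consider x where "P = pg_point x 1 (x * poly g x)" | "P = pg_point 0 0 1"
      by (auto simp: S_set_def swap23_image_pg_point)
    then show "P \<in> S_set ([:0, 1:] * h)"
    proof cases
      case (1 x)
      then show ?thesis
        \<comment> \<open>For \<open>x = 0\<close> the image is \<open>pg_point 0 1 0\<close>, the
          added point of \<open>S_set\<close>; otherwise the parameter is
          \<open>inverse (poly g x)\<close>.\<close>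
        using aff[of x] by (cases "x = 0") (auto simp: S_set_def)
    next
      case 2
      then show ?thesis
        by (auto simp: S_set_def intro!: exI[of _ 0])
    qed
  next
    fix P assume "P \<in> S_set ([:0, 1:] * h)"
    \<comment> \<open>The parameter \<open>y = 0\<close> is split off: it yields
      \<open>pg_point 0 0 1\<close>, the image of the added point.\<close>
    then consider y where "y \<noteq> 0" "P = pg_point y (y * poly h y) 1"
      | "P = pg_point 0 0 1" | "P = pg_point 0 1 0"
      by (auto simp: S_set_def) (metis mult_zero_left)
    then show "P \<in> (`) swap23 ` S_set ([:0, 1:] * g)"
    proof cases
      case (1 y)
      \<comment> \<open>This solves \<open>y = inverse (poly g x)\<close> for \<open>x\<close>, so
        that \<open>aff\<close> can be read backwards.\<close>
      define x where "x = inv (poly g) (inverse y)"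
      have gx: "poly g x = inverse y"
        unfolding x_def using g(1) by (simp add: bij_is_surj surj_f_inv_f)
      then have "x \<noteq> 0"
        using 1(1) g(2) by auto
      then have "P = swap23 ` pg_point x (x * poly g x) 1"
        using 1 gx aff[of x y] by (simp add: swap23_image_pg_point)
      then show ?thesis
        by (auto simp: S_set_def)
    next
      case 2
      then have "P = swap23 ` pg_point 0 1 0"
        by (simp add: swap23_image_pg_point)
      then show ?thesis
        by (auto simp: S_set_def)
    next
      case 3
      then have "P = swap23 ` pg_point 0 (poly ([:0, 1:] * g) 0) 1"
        by (simp add: swap23_image_pg_point)
      then show ?thesis
        unfolding S_set_def by blast
    qed
  qed
qed

theorem theorem2p9:
  fixes f g :: "'a::{field,finite} poly"
  assumes "permutation_polynomial g"
    and "poly g 0 = 0"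
    and "f = [:0, 1:] * g"
  shows "(\<exists>!h. degree h < CARD('a) \<and> permutation_polynomial h \<and> poly h 0 = 0 \<and>
            (\<forall>x. x \<noteq> 0 \<longrightarrow> poly h x = inverse (inv (poly g) (inverse x)))) \<and>
         (\<forall>h. permutation_polynomial h \<longrightarrow> poly h 0 = 0 \<longrightarrow>
            (\<forall>x. x \<noteq> 0 \<longrightarrow> poly h x = inverse (inv (poly g) (inverse x))) \<longrightarrow>
            projectively_equivalent f ([:0, 1:] * h))"
proof (intro conjI allI impI)
  have g: "bij (poly g)"
    using assms(1) by (simp add: permutation_polynomial_def)
  \<comment> \<open>As \<open>inverse 0 = 0\<close> and \<open>g(0) = 0\<close>, the formula for \<open>h\<close> also gives the value at \<open>0\<close>.\<close>
  define H where "H = inverse \<circ> inv (poly g) \<circ> (inverse :: 'a \<Rightarrow> 'a)"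
  have bij_inverse: "bij (inverse :: 'a \<Rightarrow> 'a)"
    by (rule involuntory_imp_bij) simp
  have "bij H"
    unfolding H_def by (intro bij_comp bij_inverse bij_imp_bij_inv g)
  have inv0: "inv (poly g) 0 = 0"
    using g assms(2) by (metis bij_is_inj inv_f_f)
  \<comment> \<open>The conditions on \<open>h\<close> fix its values everywhere, which reduces
    unique existence to interpolation of \<open>H\<close>.\<close>
  have "poly h = H \<longleftrightarrow> permutation_polynomial h \<and> poly h 0 = 0 \<and>
      (\<forall>x. x \<noteq> 0 \<longrightarrow> poly h x = inverse (inv (poly g) (inverse x)))" for h
  proof
    assume "poly h = H"
    then show "permutation_polynomial h \<and> poly h 0 = 0 \<and>
        (\<forall>x. x \<noteq> 0 \<longrightarrow> poly h x = inverse (inv (poly g) (inverse x)))"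
      using \<open>bij H\<close> inv0 by (simp add: permutation_polynomial_def) (simp add: H_def)
  next
    assume h: "permutation_polynomial h \<and> poly h 0 = 0 \<and>
        (\<forall>x. x \<noteq> 0 \<longrightarrow> poly h x = inverse (inv (poly g) (inverse x)))"
    show "poly h = H"
    proof
      fix x
      show "poly h x = H x"
        using h inv0 by (cases "x = 0") (auto simp: H_def)
    qed
  qed
  with poly_of_fun_ex1[of H]
  show "\<exists>!h. degree h < CARD('a) \<and> permutation_polynomial h \<and> poly h 0 = 0 \<and>
      (\<forall>x. x \<noteq> 0 \<longrightarrow> poly h x = inverse (inv (poly g) (inverse x)))"
    by simp
next
  fix h :: "'a poly"
  assume h: "poly h 0 = 0" "\<forall>x. x \<noteq> 0 \<longrightarrow> poly h x = inverse (inv (poly g) (inverse x))"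
  \<comment> \<open>Members of \<open>PGammaL3\<close> are maps restricted to
    \<open>pg_points\<close>; as \<open>S_set f\<close> consists of such points, its image is the
    same with or without the restriction.\<close>
  let ?\<kappa> = "restrict ((`) swap23) pg_points :: ('a ^ 3) set \<Rightarrow> ('a ^ 3) set"
  have "?\<kappa> ` S_set f = (`) swap23 ` S_set f"
    using S_set_subset_pg_points[of f] by (intro image_cong) auto
  also have "\<dots> = S_set ([:0, 1:] * h)"
    unfolding assms(3) using assms(1,2) h
    by (intro swap23_image_S_set) (auto simp: permutation_polynomial_def)
  finally have "?\<kappa> ` S_set f = S_set ([:0, 1:] * h)" .
  moreover have "?\<kappa> \<in> PGammaL3"
    unfolding PGammaL3_def using swap23_in_GammaL3 by (rule imageI)
  ultimately show "projectively_equivalent f ([:0, 1:] * h)"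
    unfolding projectively_equivalent_def by blast
qed

end
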